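(* Let $\Omega$ be a domain in $\mathbb C^n$ containing the origin $0$, and let $\varphi$ be a plurisubharmonic function on $\Omega$ such that $\nu_\varphi(0)>0$. Then, for any real numbers $p>q\ge s>t>-n$, $$0\le\frac{c_p(\varphi)-c_q(\varphi)}{p-q}\le\frac{c_s(\varphi)-c_t(\varphi)}{s-t}\le\frac{c_t(\varphi)}{t+n}\le\frac{1}{\nu_\varphi(0)}.$$
   Context: Plurisubharmonic functions are assumed not identically $-\infty$. $\|z\|$ is the Euclidean norm on $\mathbb C^n$. The Lelong number is $\nu_\varphi(0):=\liminf_{z\to0}\frac{\varphi(z)}{\log\|z\|}$. For real $t>-n$, the weighted log canonical threshold is $c_t(\varphi):=\sup\{c\ge0:\ \|z\|^{2t}e^{-2c\varphi}\text{ is integrable (Lebesgue measure) in some neighborhood of }0\}\in[0,+\infty]$. *)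

theory Defs
  imports "HOL-Analysis.Analysis"
begin

definition usc_on :: "'a::topological_space set \<Rightarrow> ('a \<Rightarrow> ereal) \<Rightarrow> bool" where
  "usc_on S f \<longleftrightarrow> (\<forall>x\<in>S. \<forall>c>f x. \<forall>\<^sub>F y in at x within S. f y < c)"

text \<open>
  The integral of an extended-real function, as positive part minus negative part:
  \<^const>\<open>e2ennreal\<close> sends negative arguments to 0. An upper semicontinuous function with
  values below \<open>\<infinity>\<close> is bounded above on a circle, so there the first term of the difference
  is finite and the value \<open>-\<infinity>\<close> is allowed.
\<close>

definition circle_mean :: "(complex \<Rightarrow> ereal) \<Rightarrow> complex \<Rightarrow> real \<Rightarrow> ereal" where
  "circle_mean u a r =
     (enn2ereal (\<integral>\<^sup>+\<theta>\<in>{0..2*pi}. e2ennreal (u (a + of_real r * cis \<theta>)) \<partial>lborel)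
      - enn2ereal (\<integral>\<^sup>+\<theta>\<in>{0..2*pi}. e2ennreal (- u (a + of_real r * cis \<theta>)) \<partial>lborel))
     / ereal (2*pi)"

text \<open>The function that is constantly \<open>-\<infinity>\<close> counts as subharmonic in one variable.\<close>

definition subharmonic_on :: "complex set \<Rightarrow> (complex \<Rightarrow> ereal) \<Rightarrow> bool" where
  "subharmonic_on S u \<longleftrightarrow>
     open S \<and> usc_on S u \<and> (\<forall>a\<in>S. u a < \<infinity>) \<and>
     (\<forall>a r. 0 < r \<longrightarrow> cball a r \<subseteq> S \<longrightarrow> u a \<le> circle_mean u a r)"

definition plurisubharmonic_on :: "(complex^'n) set \<Rightarrow> (complex^'n \<Rightarrow> ereal) \<Rightarrow> bool" where
  "plurisubharmonic_on \<Omega> \<phi> \<longleftrightarrow>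
     open \<Omega> \<and> usc_on \<Omega> \<phi> \<and> (\<forall>z\<in>\<Omega>. \<phi> z < \<infinity>) \<and>
     (\<forall>a b. subharmonic_on {w. a + w *s b \<in> \<Omega>} (\<lambda>w. \<phi> (a + w *s b))) \<and>
     (\<exists>z\<in>\<Omega>. \<phi> z \<noteq> -\<infinity>)"

text \<open>Here \<open>-\<infinity>\<close> divided by the negative number \<open>ln \<parallel>z\<parallel>\<close> is \<open>\<infinity>\<close>.\<close>

definition lelong_number :: "(complex^'n \<Rightarrow> ereal) \<Rightarrow> ereal" where
  "lelong_number \<phi> = Liminf (at 0) (\<lambda>z. \<phi> z / ereal (ln (norm z)))"

definition exp_ereal :: "ereal \<Rightarrow> ennreal" where
  "exp_ereal x = (if x = \<infinity> then \<infinity> else if x = -\<infinity> then 0 else ennreal (exp (real_of_ereal x)))"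

text \<open>
  For \<open>c = 0\<close> the factor \<open>e\<^sup>-\<^sup>2\<^sup>c\<^sup>\<phi>\<close> is 1, also where \<open>\<phi> = -\<infinity>\<close>, because \<open>0 * (-\<infinity>) = 0\<close> in \<^typ>\<open>ereal\<close>.
  At the single point \<open>z = 0\<close>, a null set, \<open>powr\<close> returns 0.
\<close>

definition lct_integrand :: "real \<Rightarrow> real \<Rightarrow> (complex^'n \<Rightarrow> ereal) \<Rightarrow> complex^'n \<Rightarrow> ennreal" where
  "lct_integrand t c \<phi> z = ennreal (norm z powr (2*t)) * exp_ereal (ereal (-2*c) * \<phi> z)"

definition lct_integrable :: "real \<Rightarrow> real \<Rightarrow> (complex^'n \<Rightarrow> ereal) \<Rightarrow> bool" where
  "lct_integrable t c \<phi> \<longleftrightarrow>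
     (\<exists>U. open U \<and> 0 \<in> U \<and>
        (\<lambda>z. lct_integrand t c \<phi> z * indicator U z) \<in> borel_measurable lebesgue \<and>
        (\<integral>\<^sup>+z\<in>U. lct_integrand t c \<phi> z \<partial>lebesgue) < \<infinity>)"

definition weighted_lct :: "real \<Rightarrow> (complex^'n \<Rightarrow> ereal) \<Rightarrow> ereal" where
  "weighted_lct t \<phi> = (SUP c\<in>{c. 0 \<le> c \<and> lct_integrable t c \<phi>}. ereal c)"

end

theory Submission
  imports Defs
begin

text \<open>
  Write \<open>n\<close> for the dimension, \<open>c(t)\<close> for the weighted threshold and \<open>\<nu>\<close> for the Lelong number.
  The first three inequalities hold because \<open>c\<close> is nondecreasing, concave and nonnegative on
  \<open>(-n, \<infinity>)\<close>: for such a function the slopes of successive chords decrease, and letting the left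
  endpoint of a chord tend to \<open>-n\<close> bounds every chord slope to the right of \<open>t\<close> by
  \<open>c(t) / (t + n)\<close> (\<open>concave_chord_slopes\<close>).

  Concavity is usually read off from Hoelder's inequality, but a pointwise bound is enough.
  Where \<open>\<phi>\<close> is finite, the integrand is the exponential of
  \<open>2 * t * ln \<parallel>z\<parallel> - 2 * c * \<phi> z\<close>, which is affine in \<open>(t, c)\<close>. At a convex combination of two
  parameters it is therefore at most the larger of its two values, hence at most their sum, and
  the set of \<open>(t, c)\<close> with \<open>c \<ge> 0\<close> and integrable integrand is convex
  (\<open>lct_integrable_convex_combination\<close>).
  Monotonicity holds because \<open>\<parallel>z\<parallel>\<^sup>2\<^sup>t\<close> decreases in \<open>t\<close> on the unit ball, and nonnegativity because
  \<open>c = 0\<close> is admissible for \<open>t > -n\<close>.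

  For the last inequality, \<open>\<gamma> < \<nu>\<close> gives \<open>\<phi> z \<le> \<gamma> * ln \<parallel>z\<parallel>\<close> near 0, so the integrand is at least
  \<open>\<parallel>z\<parallel> powr (2 * t - 2 * c * \<gamma>)\<close>. Both this step and nonnegativity rest on the fact that a power
  \<open>\<parallel>z\<parallel> powr a\<close> is integrable near the origin of a space of real dimension \<open>d\<close> exactly if
  \<open>a > -d\<close>. Here \<open>d = 2 * n\<close>, which yields \<open>c * \<gamma> < t + n\<close> for every admissible \<open>c\<close>
  (\<open>lct_mult_lelong_less\<close>). This also makes \<open>c(t)\<close> finite, so that the differences of
  thresholds in the theorem are differences of real numbers.
\<close>

section \<open>Integrability of powers of the norm at the origin\<close>

text \<open>
  Cover the punctured unit ball by the dyadic shells of outer radius \<open>2\<^sup>-\<^sup>k\<close>. On such a shell a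
  power with negative exponent is largest on the inner sphere, and replacing the shell by the full
  ball costs nothing in the order of magnitude. The resulting series is geometric with ratio
  \<open>(1/2) powr (b + d)\<close>, where \<open>d\<close> is the dimension and \<open>b = min a 0\<close>.
\<close>

lemma nn_integral_norm_powr_finite:
  fixes a :: real
  assumes "a > - real DIM('a::euclidean_space)"
  shows "(\<integral>\<^sup>+z\<in>ball 0 1. ennreal (norm (z::'a) powr a) \<partial>lebesgue) < \<infinity>"
proof -
  define b where "b = min a 0"
  define d where "d = DIM('a)"
  have b: "b \<le> a" "b \<le> 0" "b + real d > 0"
    using assms by (auto simp: b_def d_def min_def)
  define q where "q = (1/2) powr (b + real d)"
  have q: "0 \<le> q" "q < 1"
    using b(3) powr_less_mono'[of "1/2" 0 "b + real d"] by (auto simp: q_def)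
  define v where "v = unit_ball_vol (real d) * (1/2) powr b"
  have v: "v \<ge> 0" by (simp add: v_def)
  define g where "g k z = ennreal (((1/2) ^ Suc k) powr b) * indicator (ball 0 ((1/2)^k)) z"
    for k and z :: 'a
  have pointwise: "ennreal (norm z powr a) * indicator (ball 0 1) z \<le> (\<Sum>k. g k z)" for z :: 'a
  proof (cases "z \<in> ball 0 1 \<and> z \<noteq> 0")
    case True
    then have z: "0 < norm z" "norm z < 1" by auto
    \<comment> \<open>The index of the dyadic shell that contains \<open>z\<close>.\<close>
    define k where "k = (LEAST k. (1/2) ^ Suc k \<le> norm z)"
    obtain m where m: "(1/2::real) ^ m < norm z"
      using real_arch_pow_inv[of "norm z" "1/2"] z by auto
    have "(1/2::real) ^ Suc m \<le> norm z"
      by (rule order_trans[OF _ less_imp_le[OF m]]) auto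
    then have lower: "(1/2) ^ Suc k \<le> norm z"
      unfolding k_def by (rule LeastI)
    have upper: "norm z < (1/2) ^ k"
    proof (cases k)
      case (Suc j)
      then have "\<not> (1/2) ^ Suc j \<le> norm z"
        unfolding k_def using not_less_Least[of j "\<lambda>k. (1/2) ^ Suc k \<le> norm z"] by auto
      then show ?thesis using Suc by simp
    qed (use z in simp)
    have "norm z powr a \<le> norm z powr b"
      using z b by (intro powr_mono') auto
    also have "\<dots> \<le> ((1/2) ^ Suc k) powr b"
      using lower b z by (intro powr_mono2') auto
    finally have "ennreal (norm z powr a) * indicator (ball 0 1) z \<le> g k z"
      using upper True by (auto simp: g_def intro!: ennreal_leI)
    also have "\<dots> = (\<Sum>i\<in>{k}. g i z)" by simp
    also have "\<dots> \<le> (\<Sum>i. g i z)"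
      by (rule sum_le_suminf) auto
    finally show ?thesis .
  qed auto
  have term_int: "(\<integral>\<^sup>+z. g k z \<partial>lborel) = ennreal (v * q ^ k)" for k
  proof -
    have "(\<integral>\<^sup>+z. g k z \<partial>lborel)
        = ennreal (((1/2) ^ Suc k) powr b) * ennreal (unit_ball_vol (real d) * ((1/2)^k)^d)"
      unfolding g_def by (subst nn_integral_cmult_indicator) (auto simp: emeasure_ball d_def)
    also have "\<dots> = ennreal (((1/2) ^ Suc k) powr b * (unit_ball_vol (real d) * ((1/2)^k)^d))"
      by (simp add: ennreal_mult)
    also have "((1/2) ^ Suc k) powr b * (unit_ball_vol (real d) * ((1/2)^k)^d) = v * q ^ k"
    proof -
      have pow: "(x ^ m) powr b = (x powr b) ^ m" if "x > 0" for x :: real and m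
        by (induction m) (use that in \<open>simp_all add: powr_mult\<close>)
      have "((1/2::real) ^ Suc k) powr b = ((1/2) powr b) ^ Suc k"
        by (rule pow) simp
      moreover have "q = (1/2) powr b * (1/2) ^ d"
        by (simp add: q_def powr_add powr_realpow)
      moreover have "((1/2::real) ^ k) ^ d = ((1/2) ^ d) ^ k"
        by (metis mult.commute power_mult)
      ultimately show ?thesis
        by (simp only: v_def power_mult_distrib power_Suc mult_ac)
    qed
    finally show ?thesis .
  qed
  have "(\<integral>\<^sup>+z\<in>ball 0 1. ennreal (norm (z::'a) powr a) \<partial>lebesgue)
      \<le> (\<integral>\<^sup>+z. (\<Sum>k. g k z) \<partial>lborel)"
    unfolding nn_integral_completion by (intro nn_integral_mono pointwise)
  also have "\<dots> = (\<Sum>k. \<integral>\<^sup>+z. g k z \<partial>lborel)"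
  proof (rule nn_integral_suminf)
    show "g k \<in> borel_measurable lborel" for k
    proof -
      have [measurable]: "ball (0::'a) ((1/2)^k) \<in> sets borel" by simp
      show ?thesis unfolding g_def[abs_def] by measurable
    qed
  qed
  also have "\<dots> = ennreal (\<Sum>k. v * q ^ k)"
    unfolding term_int
  proof (rule suminf_ennreal2)
    show "summable (\<lambda>k. v * q ^ k)"
      using q by (intro summable_mult[OF summable_geometric]) auto
  qed (use v q in auto)
  also have "\<dots> < \<infinity>" by simp
  finally show ?thesis .
qed

text \<open>
  Suppose that \<open>a\<close> is at most minus the dimension. The density \<open>\<parallel>z\<parallel> powr a\<close> on a punctured ball of
  radius \<open>r \<le> 1\<close> is smallest at the boundary, and even this value makes up for the small volume:
  the mass of the ball is at least the volume \<open>w\<close> of the unit ball, for every \<open>r\<close>. Finiteness would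
  make the mass of shrinking balls tend to the mass 0 of their intersection.
\<close>

lemma exponent_gt_if_nn_integral_norm_powr_finite:
  fixes a \<rho> :: real
  assumes "\<rho> > 0"
    and fin: "(\<integral>\<^sup>+z\<in>ball 0 \<rho>. ennreal (norm (z::'a::euclidean_space) powr a) \<partial>lebesgue) < \<infinity>"
  shows "a > - real DIM('a)"
proof (rule ccontr)
  assume "\<not> a > - real DIM('a)"
  then have a: "a + real DIM('a) \<le> 0" "a \<le> 0" by auto
  define M where "M = density lborel (\<lambda>z::'a. ennreal (norm z powr a))"
  define r where "r k = min \<rho> 1 / real (Suc k)" for k
  have "r k \<le> min \<rho> 1" for k
    using divide_left_mono[of 1 "real (Suc k)" "min \<rho> 1"] \<open>\<rho> > 0\<close> by (simp add: r_def)
  then have r: "0 < r k" "r k \<le> \<rho>" "r k \<le> 1" for k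
    using \<open>\<rho> > 0\<close> by (auto simp: r_def)
  have eM: "emeasure M (ball 0 s) = (\<integral>\<^sup>+z\<in>ball 0 s. ennreal (norm (z::'a) powr a) \<partial>lborel)" for s
    unfolding M_def by (subst emeasure_density) auto
  have "emeasure M (ball 0 \<rho>) < \<infinity>"
    using fin unfolding eM nn_integral_completion .
  moreover have "emeasure M (ball 0 (r k)) \<le> emeasure M (ball 0 \<rho>)" for k
    using r(2)[of k] by (intro emeasure_mono) (auto simp: M_def)
  ultimately have "emeasure M (ball 0 (r k)) < \<infinity>" for k
    by (rule le_less_trans[rotated])
  then have finM: "emeasure M (ball 0 (r k)) \<noteq> \<infinity>" for k
    by (simp add: less_top)
  have "decseq (\<lambda>k. ball (0::'a) (r k))"
    using \<open>\<rho> > 0\<close> by (intro decseq_SucI subset_ball) (auto simp: r_def field_simps min_def)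
  then have lim: "(\<lambda>k. emeasure M (ball 0 (r k))) \<longlonglongrightarrow> emeasure M (\<Inter>k. ball 0 (r k))"
    using finM by (intro Lim_emeasure_decseq) (auto simp: M_def)
  have "r \<longlonglongrightarrow> 0"
    unfolding r_def by (rule LIMSEQ_Suc[OF lim_const_over_n])
  have "(\<Inter>k. ball (0::'a) (r k)) = {0}"
  proof (intro equalityI subsetI)
    fix z assume "z \<in> (\<Inter>k. ball (0::'a) (r k))"
    then have "\<And>k. norm z \<le> r k" by (auto intro: less_imp_le)
    then have "norm z \<le> 0"
      using \<open>r \<longlonglongrightarrow> 0\<close> by (intro LIMSEQ_le_const) auto
    then show "z \<in> {0}" by simp
  qed (use r in auto)
  moreover have "emeasure M {0} = 0"
    unfolding M_def by (subst emeasure_density) (auto simp: nn_integral_0_iff_AE indicator_def)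
  ultimately have lim0: "(\<lambda>k. emeasure M (ball 0 (r k))) \<longlonglongrightarrow> 0"
    using lim by simp
  define w where "w = unit_ball_vol (real DIM('a))"
  have "ennreal w \<le> emeasure M (ball 0 (r k))" for k
  proof -
    have "1 \<le> r k powr (a + real DIM('a))"
      using powr_mono'[of "a + real DIM('a)" 0 "r k"] a r[of k] by simp
    then have "w \<le> w * (r k powr a * r k ^ DIM('a))"
      using r(1)[of k] by (simp add: powr_add powr_realpow w_def)
    then have "ennreal w \<le> ennreal (r k powr a) * emeasure lborel (ball (0::'a) (r k))"
      using r[of k] by (simp add: emeasure_ball w_def ennreal_mult[symmetric] mult.left_commute)
    also have "\<dots> = (\<integral>\<^sup>+z. ennreal (r k powr a) * indicator (ball (0::'a) (r k)) z \<partial>lborel)"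
      by (subst nn_integral_cmult_indicator) auto
    also have "\<dots> \<le> emeasure M (ball 0 (r k))"
      unfolding eM
    proof (rule nn_integral_mono_AE)
      have "AE z in lborel. z \<noteq> (0::'a)" by (rule AE_lborel_singleton)
      then show "AE z in lborel. ennreal (r k powr a) * indicator (ball (0::'a) (r k)) z
          \<le> ennreal (norm z powr a) * indicator (ball 0 (r k)) z"
        by eventually_elim (use a in \<open>auto simp: indicator_def intro!: ennreal_leI powr_mono2'\<close>)
    qed
    finally show ?thesis .
  qed
  then have "ennreal w \<le> 0"
    using lim0 by (intro LIMSEQ_le_const) auto
  then show False
    using unit_ball_vol_pos[of "real DIM('a)"] by (simp add: w_def)
qed

section \<open>The integrand\<close>

text \<open>
  Upper semicontinuity makes the strict sublevel sets in \<open>U\<close> open. The value \<open>\<infinity>\<close> outside \<open>U\<close> keeps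
  the complement of \<open>U\<close> out of every strict sublevel set.
\<close>

lemma borel_measurable_extend_top_if_usc_on:
  fixes \<phi> :: "'a::topological_space \<Rightarrow> ereal"
  assumes "usc_on \<Omega> \<phi>" "open U" "U \<subseteq> \<Omega>"
  shows "(\<lambda>z. if z \<in> U then \<phi> z else \<infinity>) \<in> borel_measurable borel"
proof (rule borel_measurableI_less)
  fix c :: ereal
  have "open {z \<in> U. \<phi> z < c}"
  proof (subst open_subopen, rule ballI)
    fix x assume "x \<in> {z \<in> U. \<phi> z < c}"
    then have x: "x \<in> U" "x \<in> \<Omega>" "\<phi> x < c" using assms(3) by auto
    then have "\<forall>\<^sub>F y in at x within \<Omega>. \<phi> y < c"
      using assms(1) by (auto simp: usc_on_def)
    then obtain V where V: "open V" "x \<in> V" "\<And>y. y \<in> V \<Longrightarrow> y \<noteq> x \<Longrightarrow> y \<in> \<Omega> \<Longrightarrow> \<phi> y < c"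
      by (auto simp: eventually_at_topological)
    show "\<exists>T. open T \<and> x \<in> T \<and> T \<subseteq> {z \<in> U. \<phi> z < c}"
      using V x assms(2,3) by (intro exI[of _ "V \<inter> U"]) auto
  qed
  moreover have "{z \<in> space borel. (if z \<in> U then \<phi> z else \<infinity>) < c} = {z \<in> U. \<phi> z < c}"
    by auto
  ultimately show "{z \<in> space borel. (if z \<in> U then \<phi> z else \<infinity>) < c} \<in> sets borel"
    by simp
qed

lemma borel_measurable_lct_integrand:
  assumes "usc_on \<Omega> \<phi>" "open U" "U \<subseteq> \<Omega>"
  shows "(\<lambda>z. lct_integrand t c \<phi> z * indicator U z) \<in> borel_measurable lebesgue"
proof -
  define \<psi> where "\<psi> z = (if z \<in> U then \<phi> z else \<infinity>)" for z
  have [measurable]: "\<psi> \<in> borel_measurable borel" "U \<in> sets borel"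
    using borel_measurable_extend_top_if_usc_on[OF assms] assms(2)
    by (auto simp: \<psi>_def[abs_def])
  have [measurable]: "exp_ereal \<in> borel_measurable borel"
    unfolding exp_ereal_def[abs_def] by measurable
  have "(\<lambda>z. lct_integrand t c \<phi> z * indicator U z) = (\<lambda>z. lct_integrand t c \<psi> z * indicator U z)"
    by (auto simp: lct_integrand_def \<psi>_def indicator_def)
  also have "\<dots> \<in> borel_measurable borel"
    unfolding lct_integrand_def by measurable
  finally show ?thesis by (intro measurable_completion) simp
qed


lemma lct_integrand_finite_value:
  assumes "z \<noteq> 0"
  shows "lct_integrand t c (\<lambda>_. ereal x) z = ennreal (exp (2 * t * ln (norm z) - 2 * c * x))"
  using assms
  by (simp add: lct_integrand_def exp_ereal_def powr_def ennreal_mult[symmetric] exp_add[symmetric])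

text \<open>
  This replaces Hoelder's inequality: the exponential of an affine function of \<open>(t, c)\<close> is at most
  the larger of its values at the endpoints of a segment. If \<open>a\<close> and \<open>b\<close> vanish,
  the values of \<open>\<phi>\<close> do not enter. Otherwise, at points \<open>z \<noteq> 0\<close>, the right-hand side is \<open>\<infinity>\<close> where
  \<open>\<phi> z = -\<infinity>\<close>, and the left-hand side is 0 where \<open>\<phi> z = \<infinity>\<close>.
\<close>

lemma lct_integrand_convex_combination_le:
  assumes "0 \<le> a" "0 \<le> b" "0 < u" "0 < v" "u + v = (1::real)"
  shows "lct_integrand (u * p + v * q) (u * a + v * b) \<phi> z
    \<le> lct_integrand p a \<phi> z + lct_integrand q b \<phi> z"
proof (cases "z = 0")
  case True
  then show ?thesis by (simp add: lct_integrand_def)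
next
  case z: False
  have finite_value: "lct_integrand (u * p + v * q) (u * a + v * b) (\<lambda>_. ereal x) z
    \<le> lct_integrand p a (\<lambda>_. ereal x) z + lct_integrand q b (\<lambda>_. ereal x) z" for x
  proof -
    define l where "l = ln (norm z)"
    define A B where "A = 2 * p * l - 2 * a * x" and "B = 2 * q * l - 2 * b * x"
    have "2 * (u * p + v * q) * l - 2 * (u * a + v * b) * x = u * A + v * B"
      by (simp add: A_def B_def algebra_simps)
    also have "\<dots> \<le> max A B"
      using convex_bound_le[of A "max A B" B u v] assms by simp
    finally have "exp (2 * (u * p + v * q) * l - 2 * (u * a + v * b) * x) \<le> exp A + exp B"
      by (smt (verit) exp_le_cancel_iff exp_gt_zero)
    then show ?thesis
      unfolding lct_integrand_finite_value[OF z] A_def B_def l_def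
      by (simp add: ennreal_plus[symmetric] ennreal_leI del: ennreal_plus)
  qed
  show ?thesis
  proof (cases "a = 0 \<and> b = 0")
    case True
    then show ?thesis
      using finite_value[of 0] by (simp add: lct_integrand_def zero_ereal_def[symmetric])
  next
    case False
    then have ab: "a > 0 \<or> b > 0"
      using assms by auto
    then have "u * a + v * b > 0"
      using assms by (auto intro: add_pos_nonneg add_nonneg_pos)
    show ?thesis
    proof (cases "\<phi> z")
      case (real x)
      then show ?thesis using finite_value[of x] by (simp add: lct_integrand_def)
    next
      case PInf
      have "lct_integrand r c \<phi> z = 0" if "c > 0" for r c
        using that PInf by (simp add: lct_integrand_def exp_ereal_def)
      from this[OF \<open>u * a + v * b > 0\<close>] show ?thesis by simp
    next
      case MInf
      then show ?thesis using ab z \<open>u * a + v * b > 0\<close>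
        by (auto simp: lct_integrand_def exp_ereal_def ennreal_mult_top)
    qed
  qed
qed

section \<open>Admissible exponents\<close>

lemma lct_integrable_convex_combination:
  assumes "usc_on \<Omega> \<phi>" "open \<Omega>" "0 \<in> \<Omega>"
    and "lct_integrable p a \<phi>" "lct_integrable q b \<phi>"
    and "0 \<le> a" "0 \<le> b" "0 < u" "0 < v" "u + v = (1::real)"
  shows "lct_integrable (u * p + v * q) (u * a + v * b) \<phi>"
proof -
  obtain U V where U: "open U" "0 \<in> U" "(\<integral>\<^sup>+z\<in>U. lct_integrand p a \<phi> z \<partial>lebesgue) < \<infinity>"
    and V: "open V" "0 \<in> V" "(\<integral>\<^sup>+z\<in>V. lct_integrand q b \<phi> z \<partial>lebesgue) < \<infinity>"
    using assms(4,5) unfolding lct_integrable_def by blast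
  define W where "W = U \<inter> V \<inter> \<Omega>"
  have W: "open W" "0 \<in> W" "W \<subseteq> \<Omega>" "W \<subseteq> U" "W \<subseteq> V"
    using U V assms by (auto simp: W_def)
  have "(\<integral>\<^sup>+z\<in>W. lct_integrand (u * p + v * q) (u * a + v * b) \<phi> z \<partial>lebesgue)
    \<le> (\<integral>\<^sup>+z. lct_integrand p a \<phi> z * indicator W z + lct_integrand q b \<phi> z * indicator W z \<partial>lebesgue)"
    using lct_integrand_convex_combination_le[OF assms(6-10)]
    by (intro nn_integral_mono) (auto simp: indicator_def)
  also have "\<dots> = (\<integral>\<^sup>+z\<in>W. lct_integrand p a \<phi> z \<partial>lebesgue) + (\<integral>\<^sup>+z\<in>W. lct_integrand q b \<phi> z \<partial>lebesgue)"
    using W assms(1) by (intro nn_integral_add borel_measurable_lct_integrand)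
  also have "\<dots> \<le> (\<integral>\<^sup>+z\<in>U. lct_integrand p a \<phi> z \<partial>lebesgue) + (\<integral>\<^sup>+z\<in>V. lct_integrand q b \<phi> z \<partial>lebesgue)"
    using W by (intro add_mono nn_integral_mono) (auto simp: indicator_def)
  also have "\<dots> < \<infinity>" using U V by simp
  finally show ?thesis
    unfolding lct_integrable_def
    using W assms(1) borel_measurable_lct_integrand by (intro exI[of _ W]) auto
qed

lemma lct_integrable_mono:
  assumes "usc_on \<Omega> \<phi>" "open \<Omega>" "0 \<in> \<Omega>"
    and "lct_integrable q c \<phi>" "q \<le> p"
  shows "lct_integrable p c \<phi>"
proof -
  obtain U where U: "open U" "0 \<in> U" "(\<integral>\<^sup>+z\<in>U. lct_integrand q c \<phi> z \<partial>lebesgue) < \<infinity>"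
    using assms(4) unfolding lct_integrable_def by blast
  define W where "W = U \<inter> ball 0 1 \<inter> \<Omega>"
  have W: "open W" "0 \<in> W" "W \<subseteq> \<Omega>" "W \<subseteq> U" "W \<subseteq> ball 0 1"
    using U assms by (auto simp: W_def)
  have "(\<integral>\<^sup>+z\<in>W. lct_integrand p c \<phi> z \<partial>lebesgue) \<le> (\<integral>\<^sup>+z\<in>U. lct_integrand q c \<phi> z \<partial>lebesgue)"
  proof (rule nn_integral_mono)
    fix z
    have "lct_integrand p c \<phi> z \<le> lct_integrand q c \<phi> z" if "z \<in> W"
      using that W(5) assms(5) unfolding lct_integrand_def
      by (intro mult_right_mono ennreal_leI powr_mono') (auto intro: less_imp_le)
    then show "lct_integrand p c \<phi> z * indicator W z \<le> lct_integrand q c \<phi> z * indicator U z"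
      using W by (auto simp: indicator_def)
  qed
  also have "\<dots> < \<infinity>" by (fact U)
  finally show ?thesis
    unfolding lct_integrable_def
    using W assms(1) borel_measurable_lct_integrand by (intro exI[of _ W]) auto
qed

lemma lct_integrable_0:
  assumes "t > - real CARD('n)"
  shows "lct_integrable t 0 (\<phi> :: complex^'n \<Rightarrow> ereal)"
proof -
  have "lct_integrand t 0 \<phi> = (\<lambda>z. ennreal (norm z powr (2*t)))"
    by (simp add: lct_integrand_def exp_ereal_def zero_ereal_def[symmetric] fun_eq_iff)
  moreover have "(\<lambda>z::complex^'n. ennreal (norm z powr (2*t)) * indicator (ball 0 1) z)
      \<in> borel_measurable borel"
  proof -
    have [measurable]: "ball (0::complex^'n) 1 \<in> sets borel" by simp
    show ?thesis by measurable
  qed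
  ultimately show ?thesis
    using nn_integral_norm_powr_finite[where 'a = "complex^'n", of "2*t"] assms
    unfolding lct_integrable_def
    by (intro exI[of _ "ball 0 1"] conjI measurable_completion) auto
qed

section \<open>The Lelong number as an upper bound\<close>

text \<open>
  Division by \<open>ln \<parallel>z\<parallel>\<close> reverses the inequality because \<open>ln \<parallel>z\<parallel> < 0\<close> for \<open>\<parallel>z\<parallel> < 1\<close>.
\<close>

lemma eventually_le_mult_ln_norm:
  assumes "ereal \<gamma> < lelong_number \<phi>"
  shows "\<forall>\<^sub>F z in at 0. \<phi> z \<le> ereal (\<gamma> * ln (norm z))"
proof -
  have "\<forall>\<^sub>F z in at 0. ereal \<gamma> < \<phi> z / ereal (ln (norm z))"
    using assms unfolding lelong_number_def by (rule less_LiminfD)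
  moreover have "\<forall>\<^sub>F z in at (0::complex^'a). 0 < norm z \<and> norm z < 1"
    unfolding eventually_at by (intro exI[of _ 1]) auto
  ultimately show ?thesis
  proof eventually_elim
    case (elim z)
    then have "ln (norm z) < 0" by simp
    with elim show ?case
      by (cases "\<phi> z") (auto simp: neg_less_divide_eq mult.commute)
  qed
qed

text \<open>
  The integrand dominates \<open>\<parallel>z\<parallel> powr (2 * t - 2 * c * \<gamma>)\<close> near 0, whose integrability forces the
  exponent above \<open>-2 * n\<close>.
\<close>

lemma lct_mult_lelong_less:
  fixes \<phi> :: "complex^'n \<Rightarrow> ereal"
  assumes "ereal \<gamma> < lelong_number \<phi>" "0 \<le> c" "lct_integrable t c \<phi>"
  shows "c * \<gamma> < t + real CARD('n)"
proof -
  obtain U where U: "open U" "0 \<in> U" "(\<integral>\<^sup>+z\<in>U. lct_integrand t c \<phi> z \<partial>lebesgue) < \<infinity>"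
    using assms(3) unfolding lct_integrable_def by blast
  obtain r where r: "r > 0" "\<And>z. z \<noteq> 0 \<Longrightarrow> norm z < r \<Longrightarrow> \<phi> z \<le> ereal (\<gamma> * ln (norm z))"
    using eventually_le_mult_ln_norm[OF assms(1)] by (auto simp: eventually_at)
  obtain r' where r': "r' > 0" "ball 0 r' \<subseteq> U"
    using U openE by blast
  define \<rho> where "\<rho> = min r r'"
  have "\<rho> > 0" using r r' by (simp add: \<rho>_def)
  have le: "ennreal (norm z powr (2*t - 2*c*\<gamma>)) \<le> lct_integrand t c \<phi> z" if "norm z < \<rho>" for z
  proof (cases "z = 0")
    case False
    then have le: "\<phi> z \<le> ereal (\<gamma> * ln (norm z))" using r(2) that by (simp add: \<rho>_def)
    show ?thesis
    proof (cases "c = 0")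
      case True
      then show ?thesis by (simp add: lct_integrand_def exp_ereal_def zero_ereal_def[symmetric])
    next
      case False
      show ?thesis
      proof (cases "\<phi> z")
        case (real x)
        then have "c * x \<le> c * (\<gamma> * ln (norm z))"
          using le assms(2) by (intro mult_left_mono) auto
        then have "norm z powr (2*t - 2*c*\<gamma>) \<le> exp (2 * t * ln (norm z) - 2 * c * x)"
          using \<open>z \<noteq> 0\<close> by (simp add: powr_def algebra_simps)
        then show ?thesis
          using lct_integrand_finite_value[OF \<open>z \<noteq> 0\<close>, of t c x] real
          by (simp add: lct_integrand_def ennreal_leI)
      next
        case MInf
        then show ?thesis using False assms(2) \<open>z \<noteq> 0\<close>
          by (simp add: lct_integrand_def exp_ereal_def ennreal_mult_top)
      qed (use le in auto)
    qed
  qed simp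
  have "(\<integral>\<^sup>+z\<in>ball 0 \<rho>. ennreal (norm (z::complex^'n) powr (2*t - 2*c*\<gamma>)) \<partial>lebesgue)
      \<le> (\<integral>\<^sup>+z\<in>U. lct_integrand t c \<phi> z \<partial>lebesgue)"
    using le r' by (intro nn_integral_mono) (auto simp: indicator_def \<rho>_def subset_iff)
  also have "\<dots> < \<infinity>" by (fact U)
  finally have "2*t - 2*c*\<gamma> > - real DIM(complex^'n)"
    by (rule exponent_gt_if_nn_integral_norm_powr_finite[OF \<open>\<rho> > 0\<close>])
  then show ?thesis by simp
qed

section \<open>Chord slopes and the inequalities\<close>

text \<open>
  Slopes of adjacent chords of a concave function decrease. For the second bound, the slope over
  \<open>[x, t]\<close> is at most \<open>f t / (t - x)\<close> because \<open>f x \<ge> 0\<close>, and \<open>x\<close> tends to \<open>m\<close>.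
\<close>

lemma concave_chord_slopes:
  fixes f :: "real \<Rightarrow> real"
  assumes nonneg: "\<And>x. x > m \<Longrightarrow> 0 \<le> f x"
    and concave: "concave_on {m<..} f"
    and "p > q" "q \<ge> s" "s > t" "t > m"
  shows "(f p - f q) / (p - q) \<le> (f s - f t) / (s - t)"
    and "(f s - f t) / (s - t) \<le> f t / (t - m)"
proof -
  have chord: "(f z - f y) / (z - y) \<le> (f y - f x) / (y - x)" if "m < x" "x < y" "y < z" for x y z
  proof -
    \<comment> \<open>The weight of \<open>x\<close> when \<open>y\<close> is written as a convex combination of \<open>x\<close> and \<open>z\<close>.\<close>
    define u where "u = (z - y) / (z - x)"
    have u: "0 \<le> u" "u \<le> 1"
      using that by (auto simp: u_def field_simps)
    have "u * (z - x) = z - y" using that by (simp add: u_def)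
    then have "u * x + (1 - u) * z = y" by (simp add: algebra_simps)
    then have "u * f x + (1 - u) * f z \<le> f y"
      using concave[unfolded concave_on_iff] u(1,2) that
      by (elim conjE ballE[of _ _ x] ballE[of _ _ z] allE[of _ u] allE[of _ "1 - u"]) auto
    then have "(z - x) * (u * f x + (1 - u) * f z) \<le> (z - x) * f y"
      using that by (intro mult_left_mono) auto
    moreover have "(z - x) * (u * f x + (1 - u) * f z) = (z - y) * f x + (y - x) * f z"
    proof -
      have "y - x = (1 - u) * (z - x)"
        using \<open>u * (z - x) = z - y\<close> by (simp add: left_diff_distrib)
      then have "(z - y) * f x + (y - x) * f z = u * (z - x) * f x + (1 - u) * (z - x) * f z"
        using \<open>u * (z - x) = z - y\<close> by simp
      then show ?thesis by (simp add: algebra_simps)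
    qed
    ultimately have "(z - y) * f x + (y - x) * f z \<le> (z - x) * f y"
      by simp
    then show ?thesis
      using that by (simp add: field_simps)
  qed
  show "(f p - f q) / (p - q) \<le> (f s - f t) / (s - t)"
  proof (cases "q = s")
    case False
    then have "(f p - f q) / (p - q) \<le> (f q - f s) / (q - s)"
      using assms by (intro chord) auto
    also have "\<dots> \<le> (f s - f t) / (s - t)"
      using assms False by (intro chord) auto
    finally show ?thesis .
  qed (use assms chord in auto)
  define D where "D = (f s - f t) / (s - t)"
  have "D * (t - x) \<le> f t" if "m < x" "x < t" for x
  proof -
    have "D \<le> (f t - f x) / (t - x)"
      unfolding D_def using that assms by (intro chord) auto
    then show ?thesis using that nonneg[of x] by (simp add: pos_le_divide_eq)
  qed
  moreover have "((\<lambda>x. D * (t - x)) \<longlongrightarrow> D * (t - m)) (at_right m)"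
    by (intro tendsto_intros)
  ultimately have "D * (t - m) \<le> f t"
    using \<open>t > m\<close> by (intro tendsto_upperbound[of _ _ "at_right m"])
      (auto simp: eventually_at_right_field intro!: exI[of _ t])
  then show "D \<le> f t / (t - m)"
    using \<open>t > m\<close> by (simp add: pos_le_divide_eq)
qed

theorem theorem1p2:
  fixes \<Omega> :: "(complex^'n) set" and \<phi> :: "complex^'n \<Rightarrow> ereal" and p q s t :: real
  assumes "open \<Omega>" and "connected \<Omega>" and "0 \<in> \<Omega>"
    and "plurisubharmonic_on \<Omega> \<phi>"
    and "0 < lelong_number \<phi>"
    and "p > q" and "q \<ge> s" and "s > t" and "t > - real CARD('n)"
  shows "0 \<le> (weighted_lct p \<phi> - weighted_lct q \<phi>) / ereal (p - q) \<and>
    (weighted_lct p \<phi> - weighted_lct q \<phi>) / ereal (p - q)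
      \<le> (weighted_lct s \<phi> - weighted_lct t \<phi>) / ereal (s - t) \<and>
    (weighted_lct s \<phi> - weighted_lct t \<phi>) / ereal (s - t)
      \<le> weighted_lct t \<phi> / ereal (t + real CARD('n)) \<and>
    weighted_lct t \<phi> / ereal (t + real CARD('n)) \<le> 1 / lelong_number \<phi>"
proof -
  define n where "n = real CARD('n)"
  define A where "A x = {c. 0 \<le> c \<and> lct_integrable x c \<phi>}" for x
  define C where "C x = Sup (A x)" for x
  have usc: "usc_on \<Omega> \<phi>"
    using assms(4) by (simp add: plurisubharmonic_on_def)
  have A_0: "0 \<in> A x" if "x > - n" for x
    using lct_integrable_0 that by (auto simp: A_def n_def)
  have A_less: "c * \<gamma> < x + n" if "c \<in> A x" "ereal \<gamma> < lelong_number \<phi>" for c x \<gamma>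
    using lct_mult_lelong_less that by (auto simp: A_def n_def)
  obtain \<delta> where \<delta>: "0 < \<delta>" "ereal \<delta> < lelong_number \<phi>"
    using ereal_dense2[OF assms(5)] by (auto simp flip: zero_ereal_def)
  have bdd: "bdd_above (A x)" for x
    using A_less[OF _ \<delta>(2), of _ x] \<delta>(1)
    by (intro bdd_aboveI[of _ "(x + n) / \<delta>"]) (force simp: pos_le_divide_eq)
  have wlct: "weighted_lct x \<phi> = ereal (C x)" if "x > - n" for x
  proof -
    define S where "S = (SUP c\<in>A x. ereal c)"
    have "0 \<le> S"
      unfolding S_def using A_0[OF that] by (intro SUP_upper2[of 0]) auto
    moreover have "S \<le> ereal (C x)"
      unfolding S_def C_def using bdd by (intro SUP_least) (auto intro: cSup_upper)
    ultimately have "\<bar>S\<bar> \<noteq> \<infinity>" by (cases S) auto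
    then show ?thesis
      unfolding weighted_lct_def A_def[symmetric] C_def using ereal_Sup[of "A x"] by (simp add: S_def)
  qed
  have nonneg: "0 \<le> C x" if "x > - n" for x
    unfolding C_def using A_0[OF that] bdd by (rule cSup_upper)
  have mono: "C q \<le> C p"
    unfolding C_def
  proof (rule cSup_subset_mono)
    show "A q \<subseteq> A p"
      using lct_integrable_mono[OF usc assms(1,3)] \<open>p > q\<close> by (force simp: A_def)
    show "A q \<noteq> {}" using A_0[of q] assms(6-9) by (auto simp: n_def)
  qed (fact bdd)
  have concave: "concave_on {- n<..} C"
    unfolding concave_on_iff
  proof (intro conjI ballI allI impI)
    fix x y u v :: real
    assume xy: "x \<in> {- n<..}" "y \<in> {- n<..}" and uv: "0 \<le> u" "0 \<le> v" "u + v = 1"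
    show "u * C x + v * C y \<le> C (u *\<^sub>R x + v *\<^sub>R y)"
    proof (cases "u = 0 \<or> v = 0")
      case False
      then have uv': "u > 0" "v > 0" using uv by auto
      let ?z = "u * x + v * y"
      have *: "u * a + v * b \<le> C ?z" if "a \<in> A x" "b \<in> A y" for a b
        unfolding C_def
        using lct_integrable_convex_combination[OF usc assms(1,3), of x a y b u v] that uv' uv(3)
        by (intro cSup_upper bdd) (auto simp: A_def)
      have "C y \<le> (C ?z - u * a) / v" if "a \<in> A x" for a
        unfolding C_def[of y] using *[OF that] A_0[of y] xy uv'
        by (intro cSup_least) (auto simp: field_simps)
      then have "C x \<le> (C ?z - v * C y) / u"
        unfolding C_def[of x] using A_0[of x] xy uv'
        by (intro cSup_least) (auto simp: field_simps)
      then show ?thesis using uv' by (simp add: field_simps)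
    qed (use uv in auto)
  qed simp
  have lelong: "ereal (C t / (t + n)) \<le> 1 / lelong_number \<phi>"
  proof -
    have bound: "C t * \<gamma> \<le> t + n" if "0 < \<gamma>" "ereal \<gamma> < lelong_number \<phi>" for \<gamma>
    proof -
      have "C t \<le> (t + n) / \<gamma>"
        unfolding C_def using A_0[of t] A_less[OF _ that(2), of _ t] that(1) assms(9)
        by (intro cSup_least) (auto simp: n_def pos_le_divide_eq intro: less_imp_le)
      then show ?thesis using that by (simp add: pos_le_divide_eq)
    qed
    have tn: "t + n > 0" using assms(9) by (simp add: n_def)
    show ?thesis
    proof (cases "lelong_number \<phi>")
      case (real \<nu>)
      then have "\<nu> > 0" using assms(5) by simp
      have "C t * \<nu> \<le> t + n"
      proof (rule tendsto_upperbound[of "\<lambda>\<gamma>. C t * \<gamma>" _ "at_left \<nu>"])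
        show "((\<lambda>\<gamma>. C t * \<gamma>) \<longlongrightarrow> C t * \<nu>) (at_left \<nu>)" by (intro tendsto_intros)
        show "\<forall>\<^sub>F \<gamma> in at_left \<nu>. C t * \<gamma> \<le> t + n"
          using bound real \<open>\<nu> > 0\<close> by (auto simp: eventually_at_left_field intro!: exI[of _ 0])
      qed simp
      then show ?thesis using real \<open>\<nu> > 0\<close> tn by (simp add: one_ereal_def field_simps)
    next
      case PInf
      have "C t \<le> 0"
      proof (rule ccontr)
        assume "\<not> C t \<le> 0"
        then show False
          \<comment> \<open>Twice the largest \<open>\<gamma>\<close> that the bound permits.\<close>
          using bound[of "2 * (t + n) / C t"] tn PInf by simp
      qed
      then show ?thesis using PInf tn by (simp add: divide_nonpos_pos)
    qed (use assms(5) in simp)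
  qed
  have "(C p - C q) / (p - q) \<le> (C s - C t) / (s - t)"
    "(C s - C t) / (s - t) \<le> C t / (t + n)"
    using concave_chord_slopes[OF nonneg concave assms(6-8)] assms(9) by (auto simp: n_def)
  moreover have "0 \<le> (C p - C q) / (p - q)"
    using mono assms(6) by simp
  moreover have "p > - n" "q > - n" "s > - n" "t > - n"
    using assms(6-9) by (auto simp: n_def)
  moreover have "t + n > 0" using assms(9) by (simp add: n_def)
  ultimately show ?thesis
    using lelong assms(6,8) by (simp add: wlct n_def[symmetric])
qed

end
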